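(* Let $\mathcal{H}$, $\bar{\mathcal{H}}$ be graded, connected Hopf algebras over $\mathbb{R}$ with bases $\mathcal{B}=\amalg_n\mathcal{B}_n$, $\bar{\mathcal{B}}=\amalg_n\bar{\mathcal{B}}_n$ respectively, each of which satisfies the descent operator chain conditions (i)–(iii). If $\theta:\mathcal{H}\to\bar{\mathcal{H}}$ is a Hopf-morphism such that $\theta(\mathcal{B}_n)=\bar{\mathcal{B}}_n$ for all $n$, then, for every $n\ge 1$ and every probability distribution $P$ on weak-compositions of $n$, the Markov chain on $\mathcal{B}_n$ which the Doob transform constructs from the descent operator $m\circ\Delta_P$ lumps strongly via $\theta$ to the Doob transform chain on $\bar{\mathcal{B}}_n$ from the same descent operator $m\circ\Delta_P$ on $\bar{\mathcal{H}}_n$.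
   Context: All Markov chains are discrete-time, time-homogeneous, with finite state space; the transition matrix is $K(x,y)=P\{X_t=y\mid X_{t-1}=x\}$. In particular the bases $\mathcal{B}_n$ of the graded pieces $\mathcal{H}_n$ are finite. Descent operators. Let $\mathcal{H}=\bigoplus_{n\ge0}\mathcal{H}_n$ be a graded connected Hopf algebra with product $m$ and coproduct $\Delta$; $m$ also denotes the iterated product $\mathcal{H}^{\otimes l}\to\mathcal{H}$. A weak-composition of $n$ is a finite list $D=(d_1,\dots,d_{l(D)})$ of non-negative integers with sum $n$. $\Delta_D:\mathcal{H}_n\to\mathcal{H}_{d_1}\otimes\cdots\otimes\mathcal{H}_{d_{l(D)}}$ is the projection of the iterated coproduct $\mathcal{H}\to\mathcal{H}^{\otimes l(D)}$ to the graded subspace $\mathcal{H}_{d_1}\otimes\cdots\otimes\mathcal{H}_{d_{l(D)}}$. For a probability distribution $P$ on weak-compositions of $n$, $$m\circ\Delta_P:=\sum_D\frac{P(D)}{\binom{n}{d_1\,\dots\,d_{l(D)}}}\,m\circ\Delta_D:\mathcal{H}_n\to\mathcal{H}_n.$$ Descent operator chain conditions on a basis $\mathcal{B}=\amalg_n\mathcal{B}_n$ of $\mathcal{H}$ (with $\mathcal{B}_n$ a basis of $\mathcal{H}_n$): first, $\mathcal{B}_1=\{\bullet\}$ has exactly one element; and (i) for all $w,z\in\mathcal{B}$, the expansion of $m(w\otimes z)$ in $\mathcal{B}$ has all coefficients non-negative; (ii) for all $x\in\mathcal{B}$, the expansion of $\Delta(x)$ in $\mathcal{B}\otimes\mathcal{B}$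 has all coefficients non-negative; (iii) for all $x\in\mathcal{B}_n$ with $n>1$, $\Delta(x)\ne1\otimes x+x\otimes1$. (The requirement $|\mathcal{B}_1|=1$ is included whenever "conditions (i)–(iii)" are mentioned.) Doob transform chain. Under these conditions, define the rescaling function $\eta:\mathcal{B}_n\to\mathbb{R}$ (extended linearly to $\mathcal{H}_n$) by $\eta(x):=$ coefficient of $\bullet^{\otimes n}$ in $\Delta_{1,\dots,1}(x)$. It is known that $\eta>0$ on $\mathcal{B}_n$ and $\eta\circ(m\circ\Delta_P)=\eta$, and that, with $K(x,y)$ the coefficient of $y$ in $m\circ\Delta_P(x)$, the matrix $\check K(x,y):=K(x,y)\frac{\eta(y)}{\eta(x)}$ is a transition matrix on $\mathcal{B}_n$. The associated chain is the Doob transform chain from $m\circ\Delta_P$ on $\mathcal{B}_n$. The chain on $\bar{\mathcal{B}}_n$ is defined in the same way using $\bar{\mathcal{H}},\bar{\mathcal{B}}$. Strong lumping. A chain $\{X_t\}$ on $\Omega$ lumps strongly via a surjection $\theta:\Omega\to\bar\Omega$ to a chain on $\bar\Omega$ with transition matrix $\bar K$ if the process $\{\theta(X_t)\}$ is a Markov chain with transition matrix $\bar K$, irrespective of the starting distribution $X_0$. *)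

theory Defs
  imports "HOL-Probability.Probability" "HOL-Library.Poly_Mapping"
begin

section \<open>Tensor powers of a real vector space\<close>

text \<open>
  The powers \<open>V\<^sup>\<otimes>\<^sup>l\<close> for all \<open>l\<close> are housed in one type \<open>'a tensor\<close>, their direct sum:
  the free vector space on lists of vectors modulo linearity in every entry.
  The pure tensor \<open>x\<^sub>1 \<otimes> \<dots> \<otimes> x\<^sub>l\<close> is \<open>tens [x\<^sub>1, \<dots>, x\<^sub>l]\<close>, and the degree 0 part is spanned
  by \<open>tens []\<close>.
\<close>

instantiation poly_mapping :: (type, real_vector) real_vector
begin

lift_definition scaleR_poly_mapping :: "real \<Rightarrow> ('a \<Rightarrow>\<^sub>0 'b) \<Rightarrow> 'a \<Rightarrow>\<^sub>0 'b"
  is "\<lambda>r f k. r *\<^sub>R f k"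
  by (erule finite_subset[rotated]) auto

instance
  by standard (transfer; simp add: fun_eq_iff algebra_simps)+

end

lemma lookup_scaleR [simp]: "Poly_Mapping.lookup (r *\<^sub>R u) k = r *\<^sub>R Poly_Mapping.lookup u k"
  by transfer simp

definition tensor_relations :: "('a::real_vector list \<Rightarrow>\<^sub>0 real) set" where
  "tensor_relations =
     {Poly_Mapping.single (xs @ (a + b) # ys) 1
        - (Poly_Mapping.single (xs @ a # ys) 1 + Poly_Mapping.single (xs @ b # ys) 1) | xs ys a b. True}
   \<union> {Poly_Mapping.single (xs @ (r *\<^sub>R a) # ys) 1
        - r *\<^sub>R Poly_Mapping.single (xs @ a # ys) 1 | xs ys a r. True}"

definition tensor_eq :: "('a::real_vector list \<Rightarrow>\<^sub>0 real) \<Rightarrow> ('a list \<Rightarrow>\<^sub>0 real) \<Rightarrow> bool" where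
  "tensor_eq u v \<longleftrightarrow> u - v \<in> span tensor_relations"

quotient_type (overloaded) 'a tensor = "'a::real_vector list \<Rightarrow>\<^sub>0 real" / tensor_eq
proof (rule equivpI)
  show "reflp (tensor_eq :: ('a list \<Rightarrow>\<^sub>0 real) \<Rightarrow> _)"
    by (auto simp: reflp_def tensor_eq_def span_zero)
  show "symp (tensor_eq :: ('a list \<Rightarrow>\<^sub>0 real) \<Rightarrow> _)"
    unfolding symp_def tensor_eq_def by (metis minus_diff_eq span_neg)
  show "transp (tensor_eq :: ('a list \<Rightarrow>\<^sub>0 real) \<Rightarrow> _)"
  proof (rule transpI)
    fix u v w :: "'a list \<Rightarrow>\<^sub>0 real"
    assume "tensor_eq u v" "tensor_eq v w"
    moreover have "u - w = (u - v) + (v - w)" by simp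
    ultimately show "tensor_eq u w"
      unfolding tensor_eq_def using span_add by metis
  qed
qed

instantiation tensor :: (real_vector) real_vector
begin

lift_definition zero_tensor :: "'a tensor" is 0 .

lift_definition plus_tensor :: "'a tensor \<Rightarrow> 'a tensor \<Rightarrow> 'a tensor" is "(+)"
proof -
  fix u v u' v' :: "'a list \<Rightarrow>\<^sub>0 real"
  assume "tensor_eq u v" "tensor_eq u' v'"
  moreover have "(u + u') - (v + v') = (u - v) + (u' - v')" by simp
  ultimately show "tensor_eq (u + u') (v + v')"
    unfolding tensor_eq_def using span_add by metis
qed

lift_definition uminus_tensor :: "'a tensor \<Rightarrow> 'a tensor" is uminus
proof -
  fix u v :: "'a list \<Rightarrow>\<^sub>0 real"
  assume "tensor_eq u v"
  moreover have "- u - - v = - (u - v)" by simp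
  ultimately show "tensor_eq (- u) (- v)"
    unfolding tensor_eq_def using span_neg by metis
qed

lift_definition minus_tensor :: "'a tensor \<Rightarrow> 'a tensor \<Rightarrow> 'a tensor" is "(-)"
proof -
  fix u v u' v' :: "'a list \<Rightarrow>\<^sub>0 real"
  assume "tensor_eq u v" "tensor_eq u' v'"
  moreover have "(u - u') - (v - v') = (u - v) - (u' - v')" by simp
  ultimately show "tensor_eq (u - u') (v - v')"
    unfolding tensor_eq_def using span_diff by metis
qed

lift_definition scaleR_tensor :: "real \<Rightarrow> 'a tensor \<Rightarrow> 'a tensor" is "scaleR"
  unfolding tensor_eq_def by (simp only: span_scale flip: scaleR_diff_right)

instance
proof
  fix a b c :: "'a tensor" and r q :: real
  have abs: "\<exists>u. t = abs_tensor u" for t :: "'a tensor"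
    by (metis Quotient_tensor Quotient_abs_rep)
  obtain u v w where [simp]: "a = abs_tensor u" "b = abs_tensor v" "c = abs_tensor w"
    using abs by metis
  note [simp] = zero_tensor.abs_eq plus_tensor.abs_eq uminus_tensor.abs_eq minus_tensor.abs_eq
    scaleR_tensor.abs_eq
  show "a + b + c = a + (b + c)" "a + b = b + a" "0 + a = a" "- a + a = 0" "a - b = a + - b"
    by (simp_all add: add_ac)
  show "r *\<^sub>R (a + b) = r *\<^sub>R a + r *\<^sub>R b" "(r + q) *\<^sub>R a = r *\<^sub>R a + q *\<^sub>R a"
    "r *\<^sub>R q *\<^sub>R a = (r * q) *\<^sub>R a" "1 *\<^sub>R a = a"
    by (simp_all add: scaleR_add_right scaleR_add_left)
qed

end

lift_definition tens :: "'a::real_vector list \<Rightarrow> 'a tensor"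
  is "\<lambda>xs. Poly_Mapping.single xs 1" .

definition multilinear :: "('a::real_vector list \<Rightarrow> 'b::real_vector) \<Rightarrow> bool" where
  "multilinear f \<longleftrightarrow> (\<forall>xs ys. linear (\<lambda>a. f (xs @ a # ys)))"

text \<open>Meaningful for multilinear \<open>f\<close> only; then \<open>tens_lift_ex1\<close> below applies.\<close>

definition tens_lift :: "('a::real_vector list \<Rightarrow> 'b::real_vector) \<Rightarrow> 'a tensor \<Rightarrow> 'b" where
  "tens_lift f = (THE g. linear g \<and> (\<forall>xs. g (tens xs) = f xs))"

lemma multilinear_tens: "multilinear tens"
  unfolding multilinear_def
proof (intro allI linearI)
  fix xs ys :: "'a list" and a b :: 'a and r :: real
  have "Poly_Mapping.single (xs @ (a + b) # ys) (1 :: real)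
      - (Poly_Mapping.single (xs @ a # ys) 1 + Poly_Mapping.single (xs @ b # ys) 1) \<in> tensor_relations"
    unfolding tensor_relations_def by blast
  then show "tens (xs @ (a + b) # ys) = tens (xs @ a # ys) + tens (xs @ b # ys)"
    by (simp only: tens.abs_eq plus_tensor.abs_eq tensor.abs_eq_iff tensor_eq_def span_base)
  have "Poly_Mapping.single (xs @ (r *\<^sub>R a) # ys) (1 :: real)
      - r *\<^sub>R Poly_Mapping.single (xs @ a # ys) 1 \<in> tensor_relations"
    unfolding tensor_relations_def by blast
  then show "tens (xs @ (r *\<^sub>R a) # ys) = r *\<^sub>R tens (xs @ a # ys)"
    by (simp only: tens.abs_eq scaleR_tensor.abs_eq tensor.abs_eq_iff tensor_eq_def span_base)
qed

lemma poly_mapping_sum_single: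
  fixes u :: "'k \<Rightarrow>\<^sub>0 real"
  shows "u = (\<Sum>k\<in>Poly_Mapping.keys u. Poly_Mapping.lookup u k *\<^sub>R Poly_Mapping.single k 1)"
  by (rule poly_mapping_eqI)
     (auto simp: lookup_sum lookup_single when_def in_keys_iff if_distrib cong: if_cong)

lemma span_tens: "span (range tens) = (UNIV :: 'a::real_vector tensor set)"
proof -
  have "t \<in> span (range tens)" for t :: "'a tensor"
  proof -
    have abs_sum: "abs_tensor (\<Sum>k\<in>A. c k *\<^sub>R Poly_Mapping.single k 1) = (\<Sum>k\<in>A. c k *\<^sub>R tens k)"
      if "finite A" for c and A :: "'a list set"
      using that
      by (induction A rule: finite_induct)
         (simp_all add: zero_tensor_def tens_def plus_tensor.abs_eq[symmetric]
            scaleR_tensor.abs_eq[symmetric])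
    obtain u where t: "t = abs_tensor u"
      by (metis Quotient_tensor Quotient_abs_rep)
    have "t = (\<Sum>k\<in>Poly_Mapping.keys u. Poly_Mapping.lookup u k *\<^sub>R tens k)"
      using abs_sum[of "Poly_Mapping.keys u" "Poly_Mapping.lookup u"] poly_mapping_sum_single[of u] t by simp
    also have "\<dots> \<in> span (range tens)"
      by (intro span_sum span_scale span_base rangeI)
    finally show ?thesis .
  qed
  then show ?thesis by auto
qed

lemma tens_lift_ex1:
  fixes f :: "'a::real_vector list \<Rightarrow> 'b::real_vector"
  assumes f: "multilinear f"
  shows "\<exists>!g. linear g \<and> (\<forall>xs. g (tens xs) = f xs)"
proof (rule ex_ex1I)
  define g0 :: "('a list \<Rightarrow>\<^sub>0 real) \<Rightarrow> 'b" where "g0 u = (\<Sum>k\<in>Poly_Mapping.keys u. Poly_Mapping.lookup u k *\<^sub>R f k)" for u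
  have g0_super: "g0 u = (\<Sum>k\<in>A. Poly_Mapping.lookup u k *\<^sub>R f k)" if "finite A" "Poly_Mapping.keys u \<subseteq> A" for u A
    unfolding g0_def using that by (intro sum.mono_neutral_left) (auto simp: in_keys_iff)
  have lin0: "linear g0"
  proof (rule linearI)
    fix u v :: "'a list \<Rightarrow>\<^sub>0 real" and r :: real
    have "Poly_Mapping.keys (u + v) \<subseteq> Poly_Mapping.keys u \<union> Poly_Mapping.keys v" by (rule Poly_Mapping.keys_add)
    then show "g0 (u + v) = g0 u + g0 v"
      using g0_super[of "Poly_Mapping.keys u \<union> Poly_Mapping.keys v"]
      by (simp add: lookup_add scaleR_add_left sum.distrib)
    have "Poly_Mapping.keys (r *\<^sub>R u) \<subseteq> Poly_Mapping.keys u" by (auto simp: in_keys_iff)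
    then show "g0 (r *\<^sub>R u) = r *\<^sub>R g0 u"
      using g0_super[of "Poly_Mapping.keys u" "r *\<^sub>R u"] by (simp add: g0_def scaleR_sum_right)
  qed
  have g0_single: "g0 (Poly_Mapping.single k 1) = f k" for k
    by (simp add: g0_def)
  have lf: "linear (\<lambda>a. f (xs @ a # ys))" for xs ys
    using f by (simp add: multilinear_def)
  have "g0 w = 0" if "w \<in> tensor_relations" for w
    using that linear_add[OF lf] linear_scale[OF lf]
    by (auto simp: tensor_relations_def linear_diff[OF lin0] linear_add[OF lin0]
        linear_scale[OF lin0] g0_single)
  then have vanish: "g0 w = 0" if "w \<in> span tensor_relations" for w
    using linear_eq_0_on_span[OF lin0] that by blast
  define g where "g t = g0 (rep_tensor t)" for t
  have g_abs: "g (abs_tensor u) = g0 u" for u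
  proof -
    have "tensor_eq (rep_tensor (abs_tensor u)) u"
      by (metis Quotient_tensor Quotient_rep_abs tensor_equivp equivp_reflp)
    then have "g0 (rep_tensor (abs_tensor u) - u) = 0"
      by (auto simp: tensor_eq_def intro: vanish)
    then show ?thesis by (simp add: g_def linear_diff[OF lin0])
  qed
  have surj: "\<exists>u. t = abs_tensor u" for t :: "'a tensor"
    by (metis Quotient_tensor Quotient_abs_rep)
  have "linear g"
  proof (rule linearI)
    fix s t :: "'a tensor" and r :: real
    obtain u v where "s = abs_tensor u" "t = abs_tensor v" using surj by metis
    then show "g (s + t) = g s + g t" "g (r *\<^sub>R s) = r *\<^sub>R g s"
      by (simp_all add: plus_tensor.abs_eq scaleR_tensor.abs_eq g_abs
          linear_add[OF lin0] linear_scale[OF lin0])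
  qed
  then show "\<exists>g. linear g \<and> (\<forall>xs. g (tens xs) = f xs)"
    by (auto simp: tens_def g_abs g0_single)
next
  fix g h :: "'a tensor \<Rightarrow> 'b"
  assume "linear g \<and> (\<forall>xs. g (tens xs) = f xs)" "linear h \<and> (\<forall>xs. h (tens xs) = f xs)"
  then have lin: "linear g" "linear h" and "\<forall>xs. g (tens xs) = h (tens xs)" by auto
  then have eq: "g x = h x" if "x \<in> range tens" for x using that by auto
  have "g t = h t" for t
  proof (rule linear_eq_on_span[OF lin eq])
    show "t \<in> span (range tens)" by (simp only: span_tens UNIV_I)
  qed
  then show "g = h" by auto
qed

lemma tens_lift:
  assumes "multilinear f"
  shows "linear (tens_lift f)" and "tens_lift f (tens xs) = f xs"
  using theI'[OF tens_lift_ex1[OF assms]] unfolding tens_lift_def by auto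

text \<open>The linear map on the tensor square induced by a bilinear \<open>f\<close>.\<close>

definition lift2 :: "('a::real_vector \<Rightarrow> 'a \<Rightarrow> 'b::real_vector) \<Rightarrow> 'a tensor \<Rightarrow> 'b" where
  "lift2 f = tens_lift (\<lambda>zs. case zs of [x, y] \<Rightarrow> f x y | _ \<Rightarrow> 0)"

text \<open>Juxtaposition \<open>V\<^sup>\<otimes>\<^sup>k \<times> V\<^sup>\<otimes>\<^sup>l \<rightarrow> V\<^sup>\<otimes>\<^sup>(\<^sup>k\<^sup>+\<^sup>l\<^sup>)\<close>.\<close>

definition tensor_append :: "'a::real_vector tensor \<Rightarrow> 'a tensor \<Rightarrow> 'a tensor" (infixr \<open>\<otimes>\<close> 75) where
  "s \<otimes> t = tens_lift (\<lambda>xs. tens_lift (\<lambda>ys. tens (xs @ ys)) t) s"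

text \<open>The product \<open>(x\<^sub>1 \<otimes> \<dots> \<otimes> x\<^sub>l) (y\<^sub>1 \<otimes> \<dots> \<otimes> y\<^sub>l) = x\<^sub>1y\<^sub>1 \<otimes> \<dots> \<otimes> x\<^sub>ly\<^sub>l\<close> of \<open>A\<^sup>\<otimes>\<^sup>l\<close>, without signs.\<close>

definition tensor_times :: "'a::real_algebra tensor \<Rightarrow> 'a tensor \<Rightarrow> 'a tensor" where
  "tensor_times s t =
     tens_lift (\<lambda>xs. tens_lift (\<lambda>ys. if length xs = length ys then tens (map2 (*) xs ys) else 0) t) s"

definition tensor_map :: "('a::real_vector \<Rightarrow> 'b::real_vector) \<Rightarrow> 'a tensor \<Rightarrow> 'b tensor" where
  "tensor_map f = tens_lift (\<lambda>xs. tens (map f xs))"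

text \<open>If \<open>S\<close> is a basis of \<open>V\<close>, this is the basis of \<open>V\<^sup>\<otimes>\<^sup>l\<close> of pure tensors in \<open>S\<close>.\<close>

definition tensor_basis :: "nat \<Rightarrow> 'a::real_vector set \<Rightarrow> 'a tensor set" where
  "tensor_basis l S = tens ` {xs. length xs = l \<and> set xs \<subseteq> S}"


section \<open>Graded connected Hopf algebras\<close>

definition is_decomposition :: "(nat \<Rightarrow> 'a::real_vector set) \<Rightarrow> 'a \<Rightarrow> (nat \<Rightarrow> 'a) \<Rightarrow> bool" where
  "is_decomposition H x h \<longleftrightarrow>
     (\<forall>n. h n \<in> H n) \<and> finite {n. h n \<noteq> 0} \<and> (\<Sum>n | h n \<noteq> 0. h n) = x"

definition grading :: "(nat \<Rightarrow> 'a::real_vector set) \<Rightarrow> bool" where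
  "grading H \<longleftrightarrow> (\<forall>n. subspace (H n)) \<and> (\<forall>x. \<exists>!h. is_decomposition H x h)"

definition component :: "(nat \<Rightarrow> 'a::real_vector set) \<Rightarrow> nat \<Rightarrow> 'a \<Rightarrow> 'a" where
  "component H n x = (THE h. is_decomposition H x h) n"

text \<open>
  The underlying space is the whole type \<open>'a\<close>; its product and unit are those of the class
  \<open>real_algebra_1\<close>.  \<open>H n\<close> is the graded piece of degree \<open>n\<close>.
\<close>

locale graded_connected_hopf_algebra =
  fixes H :: "nat \<Rightarrow> 'a::real_algebra_1 set"
    and \<Delta> :: "'a \<Rightarrow> 'a tensor"
    and \<epsilon> :: "'a \<Rightarrow> real"
  assumes coproduct_linear: "linear \<Delta>"
    and coproduct_degree2: "\<Delta> x \<in> span {tens [a, b] | a b. True}"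
    and counit_linear: "linear \<epsilon>"
    and coassociative:
      "lift2 (\<lambda>a b. \<Delta> a \<otimes> tens [b]) (\<Delta> x) = lift2 (\<lambda>a b. tens [a] \<otimes> \<Delta> b) (\<Delta> x)"
    and counit_left: "lift2 (\<lambda>a b. \<epsilon> a *\<^sub>R b) (\<Delta> x) = x"
    and counit_right: "lift2 (\<lambda>a b. \<epsilon> b *\<^sub>R a) (\<Delta> x) = x"
    and coproduct_one: "\<Delta> 1 = tens [1, 1]"
    and coproduct_times: "\<Delta> (x * y) = tensor_times (\<Delta> x) (\<Delta> y)"
    and counit_one: "\<epsilon> 1 = 1"
    and counit_times: "\<epsilon> (x * y) = \<epsilon> x * \<epsilon> y"
    and antipode: "\<exists>S. linear S \<and>
      (\<forall>x. lift2 (\<lambda>a b. S a * b) (\<Delta> x) = \<epsilon> x *\<^sub>R 1 \<and> lift2 (\<lambda>a b. a * S b) (\<Delta> x) = \<epsilon> x *\<^sub>R 1)"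
    and grading: "grading H"
    and one_degree: "1 \<in> H 0"
    and times_degree: "a \<in> H i \<Longrightarrow> b \<in> H j \<Longrightarrow> a * b \<in> H (i + j)"
    and coproduct_degree:
      "x \<in> H n \<Longrightarrow> \<Delta> x \<in> span {tens [a, b] | a b i j. a \<in> H i \<and> b \<in> H j \<and> i + j = n}"
    and counit_degree: "x \<in> H n \<Longrightarrow> n > 0 \<Longrightarrow> \<epsilon> x = 0"
    and connected: "H 0 = span {1}"

definition hopf_morphism ::
  "('a::real_algebra_1 \<Rightarrow> 'a tensor) \<Rightarrow> ('a \<Rightarrow> real) \<Rightarrow>
   ('b::real_algebra_1 \<Rightarrow> 'b tensor) \<Rightarrow> ('b \<Rightarrow> real) \<Rightarrow> ('a \<Rightarrow> 'b) \<Rightarrow> bool" where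
  "hopf_morphism \<Delta> \<epsilon> \<Delta>' \<epsilon>' \<theta> \<longleftrightarrow>
     linear \<theta> \<and> \<theta> 1 = 1 \<and> (\<forall>x y. \<theta> (x * y) = \<theta> x * \<theta> y) \<and>
     (\<forall>x. \<Delta>' (\<theta> x) = tensor_map \<theta> (\<Delta> x)) \<and> (\<forall>x. \<epsilon>' (\<theta> x) = \<epsilon> x)"


section \<open>Descent operators and the Doob transform\<close>

definition graded_basis :: "(nat \<Rightarrow> 'a::real_vector set) \<Rightarrow> (nat \<Rightarrow> 'a set) \<Rightarrow> bool" where
  "graded_basis H B \<longleftrightarrow> (\<forall>n. finite (B n) \<and> independent (B n) \<and> span (B n) = H n)"

definition descent_chain_conditions ::
  "('a::real_algebra_1 \<Rightarrow> 'a tensor) \<Rightarrow> (nat \<Rightarrow> 'a set) \<Rightarrow> bool" where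
  "descent_chain_conditions \<Delta> B \<longleftrightarrow>
     (\<exists>b. B 1 = {b}) \<and>
     (\<forall>w\<in>\<Union>n. B n. \<forall>z\<in>\<Union>n. B n. \<forall>y\<in>\<Union>n. B n. 0 \<le> representation (\<Union>n. B n) (w * z) y) \<and>
     (\<forall>x\<in>\<Union>n. B n. \<forall>w\<in>\<Union>n. B n. \<forall>z\<in>\<Union>n. B n.
        0 \<le> representation (tensor_basis 2 (\<Union>n. B n)) (\<Delta> x) (tens [w, z])) \<and>
     (\<forall>n>1. \<forall>x\<in>B n. \<Delta> x \<noteq> tens [1, x] + tens [x, 1])"

text \<open>
  \<open>iterated_coproduct \<Delta> \<epsilon> l\<close> maps into the \<open>l\<close>-th tensor power; for \<open>l = 0\<close> it is the counit, so
  by the counit axiom it is the identity for \<open>l = 1\<close> and \<open>\<Delta>\<close> for \<open>l = 2\<close>.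
\<close>

primrec iterated_coproduct ::
  "('a::real_vector \<Rightarrow> 'a tensor) \<Rightarrow> ('a \<Rightarrow> real) \<Rightarrow> nat \<Rightarrow> 'a \<Rightarrow> 'a tensor" where
  "iterated_coproduct \<Delta> \<epsilon> 0 x = \<epsilon> x *\<^sub>R tens []"
| "iterated_coproduct \<Delta> \<epsilon> (Suc l) x =
     lift2 (\<lambda>a b. tens [a] \<otimes> iterated_coproduct \<Delta> \<epsilon> l b) (\<Delta> x)"

text \<open>\<open>\<Delta>\<^sub>D\<close>; the outer map is the projection onto \<open>H d\<^sub>1 \<otimes> \<dots> \<otimes> H d\<^sub>l\<close> for \<open>D = [d\<^sub>1, \<dots>, d\<^sub>l]\<close>.\<close>

definition coproduct_part ::
  "(nat \<Rightarrow> 'a::real_vector set) \<Rightarrow> ('a \<Rightarrow> 'a tensor) \<Rightarrow> ('a \<Rightarrow> real) \<Rightarrow> nat list \<Rightarrow> 'a \<Rightarrow> 'a tensor" where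
  "coproduct_part H \<Delta> \<epsilon> D x =
     tens_lift (\<lambda>xs. if length xs = length D then tens (map2 (component H) D xs) else 0)
       (iterated_coproduct \<Delta> \<epsilon> (length D) x)"

definition iterated_product :: "'a::real_algebra_1 tensor \<Rightarrow> 'a" where
  "iterated_product = tens_lift prod_list"

definition weak_compositions :: "nat \<Rightarrow> nat list set" where
  "weak_compositions n = {D. sum_list D = n}"

definition multinomial :: "nat list \<Rightarrow> real" where
  "multinomial D = fact (sum_list D) / (\<Prod>d\<leftarrow>D. fact d)"

text \<open>
  The operator \<open>m \<circ> \<Delta>\<^sub>P\<close> on \<open>H n\<close>.  There are infinitely many weak compositions of \<open>n\<close>, so the sum
  over \<open>D\<close> may be infinite; it is taken in the finite-dimensional space \<open>H n\<close>, that is,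
  coordinatewise with respect to the basis \<open>B n\<close>.
\<close>

definition descent_operator ::
  "(nat \<Rightarrow> 'a::real_algebra_1 set) \<Rightarrow> ('a \<Rightarrow> 'a tensor) \<Rightarrow> ('a \<Rightarrow> real) \<Rightarrow> (nat \<Rightarrow> 'a set) \<Rightarrow>
   nat \<Rightarrow> nat list pmf \<Rightarrow> 'a \<Rightarrow> 'a" where
  "descent_operator H \<Delta> \<epsilon> B n P x =
     (\<Sum>y\<in>B n. (\<Sum>\<^sub>\<infinity>D\<in>weak_compositions n. pmf P D / multinomial D *
        representation (B n) (iterated_product (coproduct_part H \<Delta> \<epsilon> D x)) y) *\<^sub>R y)"

text \<open>The coefficient is taken in the basis of \<open>(H 1)\<^sup>\<otimes>\<^sup>n\<close>, whose only element is \<open>\<bullet>\<^sup>\<otimes>\<^sup>n\<close>.\<close>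

definition rescaling ::
  "(nat \<Rightarrow> 'a::real_algebra_1 set) \<Rightarrow> ('a \<Rightarrow> 'a tensor) \<Rightarrow> ('a \<Rightarrow> real) \<Rightarrow> (nat \<Rightarrow> 'a set) \<Rightarrow>
   nat \<Rightarrow> 'a \<Rightarrow> real" where
  "rescaling H \<Delta> \<epsilon> B n x =
     representation (tensor_basis n (B 1)) (coproduct_part H \<Delta> \<epsilon> (replicate n 1) x)
       (tens (replicate n (the_elem (B 1))))"

definition doob_matrix ::
  "(nat \<Rightarrow> 'a::real_algebra_1 set) \<Rightarrow> ('a \<Rightarrow> 'a tensor) \<Rightarrow> ('a \<Rightarrow> real) \<Rightarrow> (nat \<Rightarrow> 'a set) \<Rightarrow>
   nat \<Rightarrow> nat list pmf \<Rightarrow> 'a \<Rightarrow> 'a \<Rightarrow> real" where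
  "doob_matrix H \<Delta> \<epsilon> B n P x y =
     representation (B n) (descent_operator H \<Delta> \<epsilon> B n P x) y
       * (rescaling H \<Delta> \<epsilon> B n y / rescaling H \<Delta> \<epsilon> B n x)"


section \<open>Markov chains and strong lumping\<close>

definition transition_matrix :: "'s set \<Rightarrow> ('s \<Rightarrow> 's \<Rightarrow> real) \<Rightarrow> bool" where
  "transition_matrix \<Omega> K \<longleftrightarrow> (\<forall>x\<in>\<Omega>. (\<forall>y\<in>\<Omega>. 0 \<le> K x y) \<and> (\<Sum>y\<in>\<Omega>. K x y) = 1)"

definition markov_chain ::
  "'w measure \<Rightarrow> 's set \<Rightarrow> ('s \<Rightarrow> 's \<Rightarrow> real) \<Rightarrow> (nat \<Rightarrow> 'w \<Rightarrow> 's) \<Rightarrow> bool" where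
  "markov_chain M \<Omega> K X \<longleftrightarrow>
     prob_space M \<and> finite \<Omega> \<and> transition_matrix \<Omega> K \<and>
     (\<forall>t. X t \<in> measurable M (count_space \<Omega>)) \<and>
     (\<forall>t x. \<forall>y\<in>\<Omega>. \<P>(\<omega> in M. \<forall>s\<le>t. X s \<omega> = x s) \<noteq> 0 \<longrightarrow>
        \<P>(\<omega> in M. X (Suc t) \<omega> = y \<bar> \<forall>s\<le>t. X s \<omega> = x s) = K (x t) y)"

text \<open>
  The type argument is the type of the sample space; it only serves to quantify over it.  All
  starting distributions are covered, since the law of \<open>X 0\<close> is unconstrained.
\<close>

definition lumps_strongly ::
  "'w itself \<Rightarrow> 's set \<Rightarrow> ('s \<Rightarrow> 's \<Rightarrow> real) \<Rightarrow> ('s \<Rightarrow> 'r) \<Rightarrow> 'r set \<Rightarrow> ('r \<Rightarrow> 'r \<Rightarrow> real) \<Rightarrow> bool" where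
  "lumps_strongly _ \<Omega> K \<theta> \<Omega>' K' \<longleftrightarrow> \<theta> ` \<Omega> = \<Omega>' \<and>
     (\<forall>(M :: 'w measure) X. markov_chain M \<Omega> K X \<longrightarrow> markov_chain M \<Omega>' K' (\<lambda>t \<omega>. \<theta> (X t \<omega>)))"

end

theory Submission
  imports Defs
begin

text \<open>
  A graded Hopf morphism commutes with every \<open>m \<circ> \<Delta>\<^sub>D\<close> and with \<open>\<Delta>\<^sub>1\<^sub>,\<^sub>\<dots>\<^sub>,\<^sub>1\<close>.  Since it maps basis to basis,
  the coefficient of \<open>y'\<close> in \<open>\<theta> v\<close> is the sum of the coefficients of \<open>v\<close> over the fibre of \<open>y'\<close>, and
  \<open>\<eta> \<circ> \<theta> = \<eta>\<close> because \<open>\<theta>\<close> sends \<open>\<bullet>\<close> to \<open>\<bullet>\<close>.  So the Doob matrix summed over a fibre depends only on the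
  image of the starting state, which is Dynkin's criterion for strong lumping.
\<close>

section \<open>Linear maps on tensor powers\<close>

text \<open>Pure tensors span every tensor power, so they determine a linear map. Identities in
  several tensor arguments follow by reducing one argument at a time to a pure tensor.\<close>

lemma tensor_linear_eq:
  assumes "linear f" "linear g" "\<And>xs. f (tens xs) = g (tens xs)"
  shows "f t = g t"
  using linear_eq_on_span[OF assms(1,2), of "range tens" t] assms(3) by (auto simp: span_tens)

lemma tensor_linear_mem:
  assumes "linear f" "subspace S" "\<And>xs. f (tens xs) \<in> S"
  shows "f t \<in> S"
proof -
  have "f t \<in> f ` span (range tens)" by (simp add: span_tens)
  also have "\<dots> = span (f ` range tens)" by (simp add: linear_span_image assms(1))
  also have "\<dots> \<subseteq> S" using assms(2,3) by (intro span_minimal) auto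
  finally show ?thesis .
qed

lemma case_pair_eq_0:
  "length zs \<noteq> 2 \<Longrightarrow> (case zs of [x, y] \<Rightarrow> f x y | _ \<Rightarrow> 0) = 0"
  by (cases zs; cases "tl zs"; cases "tl (tl zs)") auto

text \<open>Varying one entry leaves the length of the list unchanged, so the default value 0
  outside length 2 does not disturb linearity in that entry.\<close>

lemma multilinear_case_pair:
  assumes "bilinear f"
  shows "multilinear (\<lambda>zs. case zs of [x, y] \<Rightarrow> f x y | _ \<Rightarrow> 0)"
  unfolding multilinear_def
proof (intro allI)
  fix xs ys :: "'a list"
  \<comment> \<open>The varying entry is the first of a pair, the second of a pair, or sits in a
    list of another length.\<close>
  consider y where "xs = []" "ys = [y]" | x where "xs = [x]" "ys = []"
    | "length xs + length ys \<noteq> 1"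
    by (auto simp: add_is_1 length_Suc_conv)
  then show "linear (\<lambda>a. case xs @ a # ys of [x, y] \<Rightarrow> f x y | _ \<Rightarrow> 0)"
  proof cases
    case 3
    then have "length (xs @ a # ys) \<noteq> 2" for a by simp
    then show ?thesis by (simp add: case_pair_eq_0 linear_zero)
  qed (use assms in \<open>simp_all add: bilinear_def\<close>)
qed

lemma
  assumes "bilinear f"
  shows linear_lift2: "linear (lift2 f)"
    and lift2_tens: "lift2 f (tens zs) = (case zs of [x, y] \<Rightarrow> f x y | _ \<Rightarrow> 0)"
  using tens_lift[OF multilinear_case_pair[OF assms]] by (simp_all add: lift2_def)

lemma linear_compose_bilinear:
  "linear g \<Longrightarrow> bilinear f \<Longrightarrow> bilinear (\<lambda>a b. g (f a b))"
  by (simp add: bilinear_def linear_iff)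

lemma bilinear_compose_linear:
  assumes "bilinear f" "linear g" "linear h"
  shows "bilinear (\<lambda>a b. f (g a) (h b))"
  using assms by (simp add: bilinear_def linear_iff)

text \<open>This moves projections, products and tensor powers of morphisms inside an expression
  built from a coproduct. Lists of length other than 2 contribute 0 on both sides, because
  \<open>g 0 = 0\<close>.\<close>

lemma linear_lift2_commute:
  assumes "linear g" "bilinear f"
  shows "g (lift2 f t) = lift2 (\<lambda>a b. g (f a b)) t"
proof (rule tensor_linear_eq)
  show "linear (\<lambda>t. g (lift2 f t))"
    using linear_compose[OF linear_lift2[OF assms(2)] assms(1)] by (simp add: o_def)
  have gf: "bilinear (\<lambda>a b. g (f a b))"
    by (rule linear_compose_bilinear[OF assms])
  then show "linear (lift2 (\<lambda>a b. g (f a b)))"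
    by (rule linear_lift2)
  show "g (lift2 f (tens xs)) = lift2 (\<lambda>a b. g (f a b)) (tens xs)" for xs
    by (simp add: lift2_tens[OF assms(2)] lift2_tens[OF gf] linear_0[OF assms(1)] split: list.splits)
qed

lemma lift2_mem:
  assumes "bilinear f" "subspace S" "\<And>a b. f a b \<in> S"
  shows "lift2 f t \<in> S"
  by (rule tensor_linear_mem[OF linear_lift2[OF assms(1)] assms(2)])
    (auto simp: lift2_tens assms subspace_0 split: list.splits)

section \<open>Juxtaposition of tensors\<close>

lemma multilinear_tens_append: "multilinear (\<lambda>ys. tens (xs @ ys))"
  using multilinear_tens[unfolded multilinear_def, rule_format, of "xs @ us" for us]
  by (simp add: multilinear_def)

lemma
  shows linear_tens_lift_append: "linear (tens_lift (\<lambda>ys. tens (xs @ ys)))"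
    and tens_lift_append_tens: "tens_lift (\<lambda>ys. tens (xs @ ys)) (tens zs) = tens (xs @ zs)"
  using tens_lift[OF multilinear_tens_append] by blast+

text \<open>This legitimises the outer lift in the definition of \<open>\<otimes>\<close>. The inner
  lifts for different \<open>xs\<close> are compared on pure tensors \<open>t\<close>, where they
  are plain concatenations.\<close>

lemma multilinear_append_left: "multilinear (\<lambda>xs. tens_lift (\<lambda>ys. tens (xs @ ys)) t)"
  unfolding multilinear_def
proof (intro allI linearI)
  fix xs zs :: "'a list" and a b :: 'a and r :: real
  let ?g = "\<lambda>a. tens_lift (\<lambda>ys. tens ((xs @ a # zs) @ ys))"
  have lin: "linear (\<lambda>a. tens (us @ a # vs))" for us vs :: "'a list"
    by (rule multilinear_tens[unfolded multilinear_def, rule_format])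
  show "?g (a + b) t = ?g a t + ?g b t"
  proof (rule tensor_linear_eq[where t = t])
    show "linear (\<lambda>t. ?g a t + ?g b t)"
      by (rule linear_compose_add; rule linear_tens_lift_append)
    show "?g (a + b) (tens ys) = ?g a (tens ys) + ?g b (tens ys)" for ys
      by (simp only: tens_lift_append_tens) (simp add: linear_add[OF lin])
  qed (rule linear_tens_lift_append)
  show "?g (r *\<^sub>R a) t = r *\<^sub>R ?g a t"
  proof (rule tensor_linear_eq[where t = t])
    show "linear (\<lambda>t. r *\<^sub>R ?g a t)"
      by (rule linear_compose_scale_right; rule linear_tens_lift_append)
    show "?g (r *\<^sub>R a) (tens ys) = r *\<^sub>R ?g a (tens ys)" for ys
      by (simp only: tens_lift_append_tens) (simp add: linear_scale[OF lin])
  qed (rule linear_tens_lift_append)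
qed

lemma tens_append_eq: "tens xs \<otimes> t = tens_lift (\<lambda>ys. tens (xs @ ys)) t"
  unfolding tensor_append_def by (rule tens_lift[OF multilinear_append_left])

lemma tensor_append_tens [simp]: "tens xs \<otimes> tens ys = tens (xs @ ys)"
  unfolding tens_append_eq by (rule tens_lift_append_tens)

lemma linear_tensor_append_left: "linear (\<lambda>s. s \<otimes> t)"
  unfolding tensor_append_def by (rule tens_lift[OF multilinear_append_left])

text \<open>The right factor is buried under the outer lift. Reducing \<open>s\<close> to a pure
  tensor leaves a single lift, which is linear by construction.\<close>

lemma linear_tensor_append_right: "linear ((\<otimes>) s)"
proof (rule linearI)
  fix u v :: "'a tensor" and r :: real
  note lin = linear_tens_lift_append
  show "s \<otimes> (u + v) = s \<otimes> u + s \<otimes> v"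
  proof (rule tensor_linear_eq[where t = s])
    show "linear (\<lambda>s. s \<otimes> u + s \<otimes> v)"
      by (rule linear_compose_add; rule linear_tensor_append_left)
    show "tens xs \<otimes> (u + v) = tens xs \<otimes> u + tens xs \<otimes> v" for xs
      unfolding tens_append_eq by (rule linear_add[OF lin])
  qed (rule linear_tensor_append_left)
  show "s \<otimes> (r *\<^sub>R u) = r *\<^sub>R (s \<otimes> u)"
  proof (rule tensor_linear_eq[where t = s])
    show "linear (\<lambda>s. r *\<^sub>R (s \<otimes> u))"
      by (rule linear_compose_scale_right; rule linear_tensor_append_left)
    show "tens xs \<otimes> (r *\<^sub>R u) = r *\<^sub>R (tens xs \<otimes> u)" for xs
      unfolding tens_append_eq by (rule linear_scale[OF lin])
  qed (rule linear_tensor_append_left)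
qed

lemma bilinear_tensor_append: "bilinear (\<otimes>)"
  unfolding bilinear_def by (simp add: linear_tensor_append_left linear_tensor_append_right)

lemma linear_tens_singleton: "linear (\<lambda>a. tens [a])"
  using multilinear_tens[unfolded multilinear_def, rule_format, of "[]" "[]"] by simp

lemma bilinear_tens_append:
  "linear g \<Longrightarrow> linear h \<Longrightarrow> bilinear (\<lambda>a b. tens [g a] \<otimes> h b)"
  using bilinear_compose_linear[OF bilinear_tensor_append, of "\<lambda>a. tens [g a]" h]
    linear_compose[OF _ linear_tens_singleton, of g] by (simp add: o_def)

section \<open>Functoriality of tensor powers and iterated products\<close>

lemma multilinear_map:
  assumes "multilinear f" "linear g"
  shows "multilinear (\<lambda>xs. f (map g xs))"
  using assms by (simp add: multilinear_def linear_iff)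

lemma
  assumes "linear f"
  shows linear_tensor_map: "linear (tensor_map f)"
    and tensor_map_tens: "tensor_map f (tens xs) = tens (map f xs)"
  using tens_lift[OF multilinear_map[OF multilinear_tens assms]] by (simp_all add: tensor_map_def)

lemma tensor_map_append:
  assumes "linear f"
  shows "tensor_map f (s \<otimes> t) = tensor_map f s \<otimes> tensor_map f t"
proof (rule tensor_linear_eq[where t = s])
  note lin = linear_tensor_map[OF assms]
  show "linear (\<lambda>s. tensor_map f (s \<otimes> t))" "linear (\<lambda>s. tensor_map f s \<otimes> tensor_map f t)"
    using linear_compose[OF linear_tensor_append_left lin]
      linear_compose[OF lin linear_tensor_append_left] by (simp_all add: o_def)
  show "tensor_map f (tens xs \<otimes> t) = tensor_map f (tens xs) \<otimes> tensor_map f t" for xs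
  proof (rule tensor_linear_eq[where t = t])
    show "linear (\<lambda>t. tensor_map f (tens xs \<otimes> t))"
      using linear_compose[OF linear_tensor_append_right lin] by (simp add: o_def)
    show "linear (\<lambda>t. tensor_map f (tens xs) \<otimes> tensor_map f t)"
      using linear_compose[OF lin linear_tensor_append_right] by (simp add: o_def)
  qed (simp add: tensor_map_tens assms)
qed

text \<open>With \<open>\<Delta>' (\<theta> x) = tensor_map \<theta> (\<Delta> x)\<close>, this
  rewrites an expression over the coproduct of \<open>\<theta> x\<close> as one over the coproduct
  of \<open>x\<close>.\<close>

lemma lift2_tensor_map:
  assumes "bilinear f" "linear g"
  shows "lift2 f (tensor_map g t) = lift2 (\<lambda>a b. f (g a) (g b)) t"
proof (rule tensor_linear_eq)
  show "linear (\<lambda>t. lift2 f (tensor_map g t))"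
    using linear_compose[OF linear_tensor_map linear_lift2] assms by (simp add: o_def)
  have b: "bilinear (\<lambda>a b. f (g a) (g b))"
    by (rule bilinear_compose_linear[OF assms(1,2,2)])
  then show "linear (lift2 (\<lambda>a b. f (g a) (g b)))"
    by (rule linear_lift2)
  show "lift2 f (tensor_map g (tens xs)) = lift2 (\<lambda>a b. f (g a) (g b)) (tens xs)" for xs
    by (auto simp: lift2_tens b assms tensor_map_tens split: list.splits)
qed

lemma multilinear_prod_list: "multilinear (prod_list :: 'a::real_algebra_1 list \<Rightarrow> 'a)"
  unfolding multilinear_def by (auto intro!: linearI simp: algebra_simps)

lemma
  shows linear_iterated_product: "linear iterated_product"
    and iterated_product_tens: "iterated_product (tens xs) = prod_list xs"
  using tens_lift[OF multilinear_prod_list] by (simp_all add: iterated_product_def)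

lemma iterated_product_append:
  "iterated_product (tens [a] \<otimes> t) = a * iterated_product t"
proof (rule tensor_linear_eq)
  show "linear (\<lambda>t. iterated_product (tens [a] \<otimes> t))"
    using linear_compose[OF linear_tensor_append_right linear_iterated_product]
    by (simp add: o_def)
  show "linear (\<lambda>t. a * iterated_product t)"
    by (auto intro!: linearI simp: algebra_simps linear_add[OF linear_iterated_product]
        linear_scale[OF linear_iterated_product])
qed (simp add: iterated_product_tens)

lemma iterated_product_tensor_map:
  assumes "linear \<theta>" "\<theta> 1 = 1" "\<And>x y. \<theta> (x * y) = \<theta> x * \<theta> y"
  shows "iterated_product (tensor_map \<theta> t) = \<theta> (iterated_product t)"
proof (rule tensor_linear_eq)
  show "linear (\<lambda>t. iterated_product (tensor_map \<theta> t))" "linear (\<lambda>t. \<theta> (iterated_product t))"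
    using linear_compose[OF linear_tensor_map[OF assms(1)] linear_iterated_product]
      linear_compose[OF linear_iterated_product assms(1)] by (simp_all add: o_def)
  have "prod_list (map \<theta> xs) = \<theta> (prod_list xs)" for xs
    by (induction xs) (simp_all add: assms)
  then show "iterated_product (tensor_map \<theta> (tens xs)) = \<theta> (iterated_product (tens xs))" for xs
    by (simp add: tensor_map_tens iterated_product_tens assms(1))
qed

section \<open>Graded components\<close>

text \<open>The definition sums over the exact support, which is awkward when terms cancel or are
  mapped to 0. Any finite set containing the support serves equally well.\<close>

lemma is_decompositionI:
  assumes "\<And>n. h n \<in> H n" "finite A" "\<And>n. n \<notin> A \<Longrightarrow> h n = 0" "sum h A = x"
  shows "is_decomposition H x h"
proof -
  have "{n. h n \<noteq> 0} \<subseteq> A" using assms(3) by blast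
  then have "finite {n. h n \<noteq> 0}" "sum h {n. h n \<noteq> 0} = sum h A"
    using assms(2) by (auto intro: finite_subset sum.mono_neutral_left)
  then show ?thesis using assms by (simp add: is_decomposition_def)
qed

context
  fixes H :: "nat \<Rightarrow> 'a::real_vector set"
  assumes grading: "grading H"
begin

lemma subspace_degree: "subspace (H n)"
  using grading by (simp add: grading_def)

lemma is_decomposition_component: "is_decomposition H x (\<lambda>n. component H n x)"
  using grading theI'[of "is_decomposition H x"] by (simp add: grading_def component_def)

lemma component_eq: "is_decomposition H x h \<Longrightarrow> component H n x = h n"
  using grading is_decomposition_component[of x] unfolding grading_def by metis

lemma component_mem: "component H n x \<in> H n"
  using is_decomposition_component by (simp add: is_decomposition_def)

lemma finite_component: "finite {n. component H n x \<noteq> 0}"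
  using is_decomposition_component by (simp add: is_decomposition_def)

lemma sum_component:
  assumes "finite A" "{n. component H n x \<noteq> 0} \<subseteq> A"
  shows "(\<Sum>n\<in>A. component H n x) = x"
proof -
  have "(\<Sum>n\<in>A. component H n x) = (\<Sum>n | component H n x \<noteq> 0. component H n x)"
    using assms by (intro sum.mono_neutral_right) auto
  then show ?thesis
    using is_decomposition_component by (simp add: is_decomposition_def)
qed

text \<open>Adding or scaling decompositions termwise gives decompositions again, and decompositions
  are unique.\<close>

lemma linear_component: "linear (component H n)"
proof (rule linearI)
  fix x y :: 'a and r :: real
  let ?A = "{n. component H n x \<noteq> 0} \<union> {n. component H n y \<noteq> 0}"
  have "is_decomposition H (x + y) (\<lambda>n. component H n x + component H n y)"
    by (rule is_decompositionI[where A = ?A])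
      (auto simp: sum.distrib sum_component finite_component component_mem
        intro: subspace_add[OF subspace_degree])
  then show "component H n (x + y) = component H n x + component H n y"
    by (rule component_eq)
  have "is_decomposition H (r *\<^sub>R x) (\<lambda>n. r *\<^sub>R component H n x)"
    by (rule is_decompositionI[where A = ?A])
      (auto simp: sum_component finite_component component_mem simp flip: scaleR_sum_right
        intro: subspace_scale[OF subspace_degree])
  then show "component H n (r *\<^sub>R x) = r *\<^sub>R component H n x"
    by (rule component_eq)
qed

end

text \<open>Applying \<open>\<theta>\<close> to each component of \<open>x\<close> gives a
  decomposition of \<open>\<theta> x\<close>, and uniqueness identifies it with the components
  there.\<close>

lemma component_linear_image:
  assumes H: "grading H" and H': "grading H'" and \<theta>: "linear \<theta>" and sub: "\<And>k. \<theta> ` H k \<subseteq> H' k"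
  shows "component H' n (\<theta> x) = \<theta> (component H n x)"
proof (rule component_eq[OF H'])
  show "is_decomposition H' (\<theta> x) (\<lambda>n. \<theta> (component H n x))"
  proof (rule is_decompositionI[OF _ finite_component[OF H, of x]])
    show "\<theta> (component H n x) \<in> H' n" for n
      using sub component_mem[OF H] by blast
    show "(\<Sum>n | component H n x \<noteq> 0. \<theta> (component H n x)) = \<theta> x"
      by (simp flip: linear_sum[OF \<theta>] add: sum_component[OF H finite_component[OF H] subset_refl])
  qed (simp add: linear_0[OF \<theta>])
qed

section \<open>Projection onto a multidegree: the tensor product of the component maps\<close>

definition degree_projection :: "(nat \<Rightarrow> 'a::real_vector set) \<Rightarrow> nat list \<Rightarrow> 'a tensor \<Rightarrow> 'a tensor" where
  "degree_projection H D =
     tens_lift (\<lambda>xs. if length xs = length D then tens (map2 (component H) D xs) else 0)"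

lemma multilinear_map2:
  fixes c :: "'d \<Rightarrow> 'a::real_vector \<Rightarrow> 'b::real_vector"
  assumes "\<And>d. linear (c d)"
  shows "multilinear (\<lambda>xs. if length xs = length D then tens (map2 c D xs) else 0)"
  unfolding multilinear_def
proof (intro allI)
  fix xs ys :: "'a list"
  show "linear (\<lambda>a. if length (xs @ a # ys) = length D then tens (map2 c D (xs @ a # ys)) else 0)"
  proof (cases "length xs + Suc (length ys) = length D")
    case True
    then have "length xs < length D" by linarith
    \<comment> \<open>\<open>D\<close> is cut at the position of the varying entry, so that
      \<open>d\<close> is the index acting on that entry and \<open>c d\<close> is composed with a
      slot of \<open>tens\<close>.\<close>
    then obtain D1 d D2 where D: "D = D1 @ d # D2" and len: "length D1 = length xs"
      by (metis id_take_nth_drop length_take min_absorb2 less_imp_le)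
    have "linear (\<lambda>a. tens (map2 c D1 xs @ a # map2 c D2 ys))"
      by (rule multilinear_tens[unfolded multilinear_def, rule_format])
    from linear_compose[OF assms[of d] this] True len show ?thesis
      by (simp add: D o_def)
  qed (simp add: linear_zero)
qed

lemma
  assumes "grading H"
  shows linear_degree_projection: "linear (degree_projection H D)"
    and degree_projection_tens: "degree_projection H D (tens xs) =
      (if length xs = length D then tens (map2 (component H) D xs) else 0)"
  using tens_lift[OF multilinear_map2, of "component H" D] linear_component[OF assms]
  by (simp_all add: degree_projection_def)

lemma degree_projection_append:
  assumes "grading H"
  shows "degree_projection H (d # D) (tens [a] \<otimes> t) = tens [component H d a] \<otimes> degree_projection H D t"
proof (rule tensor_linear_eq[where t = t])
  note lin = linear_degree_projection[OF assms]
  show "linear (\<lambda>t. degree_projection H (d # D) (tens [a] \<otimes> t))"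
    "linear (\<lambda>t. tens [component H d a] \<otimes> degree_projection H D t)"
    using linear_compose[OF linear_tensor_append_right lin]
      linear_compose[OF lin linear_tensor_append_right] by (simp_all add: o_def)
qed (simp add: degree_projection_tens[OF assms] linear_0[OF linear_tensor_append_right])

section \<open>Descent operators under Hopf morphisms\<close>

definition descent_term ::
  "(nat \<Rightarrow> 'a::real_algebra_1 set) \<Rightarrow> ('a \<Rightarrow> 'a tensor) \<Rightarrow> ('a \<Rightarrow> real) \<Rightarrow> nat list \<Rightarrow> 'a \<Rightarrow> 'a" where
  "descent_term H \<Delta> \<epsilon> D x = iterated_product (coproduct_part H \<Delta> \<epsilon> D x)"

lemma coproduct_part_eq:
  "coproduct_part H \<Delta> \<epsilon> D x = degree_projection H D (iterated_coproduct \<Delta> \<epsilon> (length D) x)"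
  by (simp add: coproduct_part_def degree_projection_def)

context graded_connected_hopf_algebra
begin

lemma linear_iterated_coproduct: "linear (iterated_coproduct \<Delta> \<epsilon> l)"
proof (induction l)
  case 0
  then show ?case
    using counit_linear by (simp add: linear_iff scaleR_add_left)
next
  case (Suc l)
  have "bilinear (\<lambda>a b. tens [a] \<otimes> iterated_coproduct \<Delta> \<epsilon> l b)"
    by (rule bilinear_tens_append[OF linear_ident Suc])
  from linear_compose[OF coproduct_linear linear_lift2[OF this]] show ?case
    by (simp add: o_def)
qed

lemma linear_coproduct_part: "linear (coproduct_part H \<Delta> \<epsilon> D)"
  using linear_compose[OF linear_iterated_coproduct linear_degree_projection[OF grading]]
  by (simp add: coproduct_part_eq[abs_def] o_def)

lemma coproduct_part_Nil: "coproduct_part H \<Delta> \<epsilon> [] x = \<epsilon> x *\<^sub>R tens []"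
  by (simp add: coproduct_part_eq linear_scale[OF linear_degree_projection[OF grading]]
      degree_projection_tens[OF grading])

text \<open>The projection acts factor by factor, so the recursion of the iterated coproduct passes
  to its multigraded parts. This drives the inductions on \<open>D\<close>.\<close>

lemma coproduct_part_Cons:
  "coproduct_part H \<Delta> \<epsilon> (d # D) x =
     lift2 (\<lambda>a b. tens [component H d a] \<otimes> coproduct_part H \<Delta> \<epsilon> D b) (\<Delta> x)"
  by (simp add: coproduct_part_eq
      linear_lift2_commute[OF linear_degree_projection[OF grading]
        bilinear_tens_append[OF linear_ident linear_iterated_coproduct]]
      degree_projection_append[OF grading])

lemma bilinear_coproduct_part:
  "bilinear (\<lambda>a b. tens [component H d a] \<otimes> coproduct_part H \<Delta> \<epsilon> D b)"
  by (rule bilinear_tens_append[OF linear_component[OF grading] linear_coproduct_part])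

lemma linear_descent_term: "linear (descent_term H \<Delta> \<epsilon> D)"
  using linear_compose[OF linear_coproduct_part linear_iterated_product]
  by (simp add: descent_term_def[abs_def] o_def)

lemma descent_term_Nil: "descent_term H \<Delta> \<epsilon> [] x = \<epsilon> x *\<^sub>R 1"
  by (simp add: descent_term_def coproduct_part_Nil linear_scale[OF linear_iterated_product]
      iterated_product_tens)

text \<open>This exhibits the operator for \<open>D\<close> as a convolution product of the
  projections onto the degrees listed in \<open>D\<close>.\<close>

lemma descent_term_Cons:
  "descent_term H \<Delta> \<epsilon> (d # D) x = lift2 (\<lambda>a b. component H d a * descent_term H \<Delta> \<epsilon> D b) (\<Delta> x)"
  by (simp add: descent_term_def coproduct_part_Cons iterated_product_append
      linear_lift2_commute[OF linear_iterated_product bilinear_coproduct_part])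

text \<open>By connectedness the degree 0 component is a multiple of 1. The counit kills all other
  components and sends 1 to 1, so it reads off the scalar.\<close>

lemma component_0: "component H 0 x = \<epsilon> x *\<^sub>R 1"
proof -
  \<comment> \<open>The index 0 is inserted so that the degree 0 term is present even if it
    vanishes.\<close>
  let ?A = "insert 0 {n. component H n x \<noteq> 0}"
  have "component H 0 x \<in> span {1}"
    using component_mem[OF grading, of 0] connected by simp
  then obtain c where c: "component H 0 x = c *\<^sub>R 1"
    by (auto simp: span_singleton)
  have fin: "finite ?A" using finite_component[OF grading] by simp
  have "\<epsilon> x = \<epsilon> (\<Sum>n\<in>?A. component H n x)"
    by (subst sum_component[OF grading fin]) auto
  also have "\<dots> = (\<Sum>n\<in>?A. \<epsilon> (component H n x))"
    by (rule linear_sum[OF counit_linear])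
  also have "\<dots> = (\<Sum>n\<in>{0}. \<epsilon> (component H n x))"
    using fin counit_degree[OF component_mem[OF grading]]
    by (intro sum.mono_neutral_right) auto
  finally show ?thesis
    using counit_one by (simp add: c linear_scale[OF counit_linear])
qed

text \<open>The projection onto degree 0 is the unit for convolution.\<close>

lemma descent_term_0_Cons: "descent_term H \<Delta> \<epsilon> (0 # D) x = descent_term H \<Delta> \<epsilon> D x"
proof -
  have "bilinear (\<lambda>a b. \<epsilon> a *\<^sub>R b)"
    using counit_linear by (simp add: bilinear_def linear_iff algebra_simps)
  from linear_lift2_commute[OF linear_descent_term this]
  have "descent_term H \<Delta> \<epsilon> D (lift2 (\<lambda>a b. \<epsilon> a *\<^sub>R b) (\<Delta> x)) =
      lift2 (\<lambda>a b. \<epsilon> a *\<^sub>R descent_term H \<Delta> \<epsilon> D b) (\<Delta> x)"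
    by (simp add: linear_scale[OF linear_descent_term])
  then show ?thesis
    by (simp add: descent_term_Cons component_0 counit_left)
qed

lemma descent_term_filter:
  "descent_term H \<Delta> \<epsilon> (filter ((\<noteq>) 0) D) x = descent_term H \<Delta> \<epsilon> D x"
  by (induction D arbitrary: x) (simp_all add: descent_term_0_Cons, simp add: descent_term_Cons)

text \<open>Degrees add under multiplication. Membership is what makes coordinates with respect to
  \<open>B n\<close> meaningful for the terms of the descent operator.\<close>

lemma descent_term_mem: "descent_term H \<Delta> \<epsilon> D x \<in> H (sum_list D)"
proof (induction D arbitrary: x)
  case Nil
  then show ?case
    using subspace_scale[OF subspace_degree[OF grading] one_degree] by (simp add: descent_term_Nil)
next
  case (Cons d D)
  have "bilinear (\<lambda>a b. component H d a * descent_term H \<Delta> \<epsilon> D b)"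
    by (rule bilinear_compose_linear[OF bilinear_times linear_component[OF grading] linear_descent_term])
  then show ?case
    unfolding descent_term_Cons
    by (rule lift2_mem[OF _ subspace_degree[OF grading]])
      (simp add: times_degree component_mem[OF grading] Cons)
qed

end

text \<open>\<open>hopf_morphism\<close> does not mention degrees, so compatibility with the
  gradings is stated separately; in the theorem it follows from \<open>\<theta>\<close> mapping
  bases onto bases.\<close>

locale graded_hopf_morphism =
  dom: graded_connected_hopf_algebra H \<Delta> \<epsilon> + cod: graded_connected_hopf_algebra H' \<Delta>' \<epsilon>'
  for H :: "nat \<Rightarrow> 'a::real_algebra_1 set" and \<Delta> \<epsilon>
    and H' :: "nat \<Rightarrow> 'b::real_algebra_1 set" and \<Delta>' \<epsilon>' +
  fixes \<theta> :: "'a \<Rightarrow> 'b"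
  assumes hopf_morphism: "hopf_morphism \<Delta> \<epsilon> \<Delta>' \<epsilon>' \<theta>"
    and degree_image: "\<And>k. \<theta> ` H k \<subseteq> H' k"
begin

lemma linear_hom: "linear \<theta>"
  using hopf_morphism by (simp add: hopf_morphism_def)

text \<open>Induction on \<open>D\<close>: the empty list is compatibility with the counits; each
  further entry uses compatibility with the coproducts and with components.\<close>

lemma coproduct_part_hom:
  "coproduct_part H' \<Delta>' \<epsilon>' D (\<theta> x) = tensor_map \<theta> (coproduct_part H \<Delta> \<epsilon> D x)"
proof (induction D arbitrary: x)
  case Nil
  then show ?case
    using hopf_morphism
    by (simp add: dom.coproduct_part_Nil cod.coproduct_part_Nil tensor_map_tens linear_hom
        linear_scale[OF linear_tensor_map] hopf_morphism_def)
next
  case (Cons d D)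
  have "tensor_map \<theta> (coproduct_part H \<Delta> \<epsilon> (d # D) x) =
      lift2 (\<lambda>a b. tens [component H' d (\<theta> a)] \<otimes> coproduct_part H' \<Delta>' \<epsilon>' D (\<theta> b)) (\<Delta> x)"
    by (simp add: dom.coproduct_part_Cons
        linear_lift2_commute[OF linear_tensor_map[OF linear_hom] dom.bilinear_coproduct_part]
        tensor_map_append[OF linear_hom] tensor_map_tens[OF linear_hom] Cons
        component_linear_image[OF dom.grading cod.grading linear_hom degree_image])
  also have "\<dots> = coproduct_part H' \<Delta>' \<epsilon>' (d # D) (\<theta> x)"
    using hopf_morphism
    by (simp add: cod.coproduct_part_Cons hopf_morphism_def
        lift2_tensor_map[OF cod.bilinear_coproduct_part linear_hom])
  finally show ?case ..
qed

lemma descent_term_hom: "descent_term H' \<Delta>' \<epsilon>' D (\<theta> x) = \<theta> (descent_term H \<Delta> \<epsilon> D x)"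
  using hopf_morphism
  by (simp add: descent_term_def coproduct_part_hom hopf_morphism_def iterated_product_tensor_map)

end

section \<open>Coordinates, and the line spanned by a tensor power of one vector\<close>

lemma representation_linear_image:
  fixes \<theta> :: "'a::real_vector \<Rightarrow> 'b::real_vector"
  assumes "finite B" "independent B" "independent B'" "linear \<theta>" "\<theta> ` B \<subseteq> B'" "v \<in> span B"
  shows "representation B' (\<theta> v) y' = (\<Sum>y | y \<in> B \<and> \<theta> y = y'. representation B v y)"
proof -
  have "\<theta> v = \<theta> (\<Sum>y\<in>B. representation B v y *\<^sub>R y)"
    by (simp add: real_vector.sum_representation_eq assms)
  also have "\<dots> = (\<Sum>y\<in>B. representation B v y *\<^sub>R \<theta> y)"
    by (simp add: linear_sum[OF assms(4)] linear_scale[OF assms(4)])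
  finally have "representation B' (\<theta> v) y' = (\<Sum>y\<in>B. representation B' (representation B v y *\<^sub>R \<theta> y) y')"
    using assms(3,5) by (simp add: real_vector.representation_sum span_scale span_base image_subset_iff)
  \<comment> \<open>Several basis vectors may share the image \<open>y'\<close>, so their
    coefficients accumulate; an empty fibre gives 0.\<close>
  also have "\<dots> = (\<Sum>y\<in>B. if \<theta> y = y' then representation B v y else 0)"
    using assms(3,5) by (intro sum.cong refl)
      (auto simp add: real_vector.representation_scale real_vector.representation_basis
        span_base image_subset_iff)
  also have "\<dots> = (\<Sum>y | y \<in> B \<and> \<theta> y = y'. representation B v y)"
    using assms(1) by (simp add: sum.inter_filter)
  finally show ?thesis .
qed

lemma tens_scaled_replicate:
  "tens (map (\<lambda>c. c *\<^sub>R b) cs) = prod_list cs *\<^sub>R tens (replicate (length cs) b)"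
proof (induction cs)
  case (Cons c cs)
  have "tens (map (\<lambda>c. c *\<^sub>R b) (c # cs)) = tens [c *\<^sub>R b] \<otimes> tens (map (\<lambda>c. c *\<^sub>R b) cs)"
    by simp
  also have "\<dots> = (c *\<^sub>R tens [b]) \<otimes> (prod_list cs *\<^sub>R tens (replicate (length cs) b))"
    by (simp only: Cons.IH linear_scale[OF linear_tens_singleton])
  also have "\<dots> = prod_list (c # cs) *\<^sub>R tens (replicate (length (c # cs)) b)"
    by (simp add: linear_scale[OF linear_tensor_append_left] linear_scale[OF linear_tensor_append_right]
        mult.commute)
  finally show ?case .
qed simp

lemma tens_replicate_nonzero:
  assumes "b \<noteq> 0"
  shows "tens (replicate n b) \<noteq> 0"
proof
  assume zero: "tens (replicate n b) = 0"
  have "independent {b}" using assms by simp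
  \<comment> \<open>A functional normalised at \<open>b\<close> induces the multilinear product of
    its values, which equals 1 on the tensor power of \<open>b\<close>.\<close>
  then obtain f :: "'a \<Rightarrow> real" where f: "linear f" "f b = 1"
    using linear_independent_extend[of "{b}" "\<lambda>_. 1"] by auto
  note lift = tens_lift[OF multilinear_map[OF multilinear_prod_list f(1)]]
  have "prod_list (map f (replicate n b)) = 0"
    using lift(2)[of "replicate n b"] linear_0[OF lift(1)] by (simp only: zero)
  then show False by (simp add: f(2))
qed

lemma tensor_basis_singleton: "tensor_basis n {b} = {tens (replicate n b)}"
proof -
  have "{xs. length xs = n \<and> set xs \<subseteq> {b}} = {replicate n b}"
    by (auto intro: replicate_eqI)
  then show ?thesis by (simp add: tensor_basis_def)
qed

text \<open>In degree 1 every component is a multiple of \<open>b\<close>, and the scalars from the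
  slots multiply together in front of one tensor.\<close>

lemma degree_projection_replicate_mem:
  assumes H: "grading H" and H1: "H 1 = span {b}"
  shows "degree_projection H (replicate n 1) t \<in> span {tens (replicate n b)}"
proof (rule tensor_linear_mem[OF linear_degree_projection[OF H] subspace_span])
  fix xs
  have "\<exists>c. component H 1 x = c *\<^sub>R b" for x
    using component_mem[OF H, of 1 x] H1 by (auto simp: span_singleton)
  then obtain c where c: "\<And>x. component H 1 x = c x *\<^sub>R b" by metis
  show "degree_projection H (replicate n 1) (tens xs) \<in> span {tens (replicate n b)}"
  proof (cases "length xs = n")
    case True
    then have "map2 (component H) (replicate n 1) xs = map (\<lambda>c. c *\<^sub>R b) (map c xs)"
      by (intro nth_equalityI) (simp_all add: c del: One_nat_def)
    then show ?thesis
      by (simp add: degree_projection_tens[OF H] True tens_scaled_replicate span_base span_scale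
          del: map_map One_nat_def)
  qed (simp add: degree_projection_tens[OF H] span_zero)
qed

section \<open>Convergence of the descent operator\<close>

text \<open>When all parts are positive, both the parts and their number are at most
  \<open>n\<close>.\<close>

lemma finite_positive_compositions: "finite {E. sum_list E = n \<and> (0::nat) \<notin> set E}"
proof (rule finite_subset)
  have "length E \<le> sum_list E" if "0 \<notin> set E" for E :: "nat list"
    using that by (induction E) auto
  then show "{E. sum_list E = n \<and> 0 \<notin> set E} \<subseteq> {E. set E \<subseteq> {..n} \<and> length E \<le> n}"
    by (auto intro: member_le_sum_list)
qed (simp add: finite_lists_length_le)

lemma multinomial_filter: "multinomial (filter ((\<noteq>) 0) D) = multinomial D"
proof -
  have "sum_list (filter ((\<noteq>) 0) D) = sum_list D"
    "(\<Prod>d\<leftarrow>filter ((\<noteq>) 0) D. fact d :: real) = (\<Prod>d\<leftarrow>D. fact d)"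
    by (induction D) auto
  then show ?thesis by (simp add: multinomial_def)
qed

lemma pmf_mult_bounded_summable:
  fixes h :: "'c \<Rightarrow> real"
  assumes "\<And>x. x \<in> A \<Longrightarrow> \<bar>h x\<bar> \<le> C"
  shows "(\<lambda>x. pmf p x * h x) summable_on A"
proof -
  have "pmf p summable_on A"
    using pmf_abs_summable[of p A] by (simp flip: abs_summable_equivalent)
  then have "(\<lambda>x. pmf p x * C) summable_on A"
    by (rule summable_on_cmult_left)
  then have "(\<lambda>x. norm (pmf p x * h x)) summable_on A"
    by (rule summable_on_comparison_test) (auto simp: abs_mult intro: mult_left_mono assms)
  then show ?thesis by (rule abs_summable_summable)
qed

lemma has_sum_finite_sum:
  fixes f :: "'i \<Rightarrow> 'k \<Rightarrow> real"
  assumes "finite I" "\<And>i. i \<in> I \<Longrightarrow> (f i has_sum s i) A"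
  shows "((\<lambda>x. \<Sum>i\<in>I. f i x) has_sum (\<Sum>i\<in>I. s i)) A"
  using assms by (induction I rule: finite_induct) (auto intro: has_sum_add)

lemma representation_descent_operator:
  assumes "finite (B n)" "independent (B n)" "y \<in> B n"
  shows "representation (B n) (descent_operator H \<Delta> \<epsilon> B n P x) y =
    (\<Sum>\<^sub>\<infinity>D\<in>weak_compositions n. pmf P D / multinomial D *
        representation (B n) (descent_term H \<Delta> \<epsilon> D x) y)"
  unfolding descent_operator_def descent_term_def using assms
  by (simp add: real_vector.representation_sum real_vector.representation_scale
      real_vector.representation_basis span_base span_scale if_distrib cong: if_cong)

text \<open>
  Zero parts of \<open>D\<close> change neither the term nor its multinomial coefficient, so only finitely
  many different coefficients occur in the infinite sum over weak compositions.
\<close>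

lemma (in graded_connected_hopf_algebra) descent_coefficient_summable:
  "(\<lambda>D. pmf P D / multinomial D * representation (B n) (descent_term H \<Delta> \<epsilon> D x) y)
     summable_on weak_compositions n"
proof -
  define h where "h D = representation (B n) (descent_term H \<Delta> \<epsilon> D x) y / multinomial D" for D
  let ?E = "{E. sum_list E = n \<and> 0 \<notin> set E}"
  have "\<bar>h D\<bar> \<le> Max ((\<lambda>E. \<bar>h E\<bar>) ` ?E)" if "D \<in> weak_compositions n" for D
  proof (rule Max_ge)
    have "sum_list (filter ((\<noteq>) 0) D) = sum_list D" by (induction D) auto
    then have "filter ((\<noteq>) 0) D \<in> ?E" using that by (auto simp: weak_compositions_def)
    moreover have "h D = h (filter ((\<noteq>) 0) D)"
      by (simp only: h_def descent_term_filter multinomial_filter)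
    ultimately show "\<bar>h D\<bar> \<in> (\<lambda>E. \<bar>h E\<bar>) ` ?E" by auto
  qed (simp add: finite_positive_compositions)
  from pmf_mult_bounded_summable[of "weak_compositions n" h, OF this, of P] show ?thesis
    by (simp add: h_def)
qed

section \<open>Strong lumping\<close>

text \<open>A past of the image process is a finite disjoint union of pasts of the chain. By
  \<open>lump\<close>, each of these leads into the target fibre with the same conditional
  probability whenever it has positive probability.\<close>

lemma lumps_stronglyI:
  fixes K :: "'s \<Rightarrow> 's \<Rightarrow> real"
  assumes \<Omega>': "\<theta> ` \<Omega> = \<Omega>'"
    and lump: "\<And>x y'. x \<in> \<Omega> \<Longrightarrow> y' \<in> \<Omega>' \<Longrightarrow> (\<Sum>y | y \<in> \<Omega> \<and> \<theta> y = y'. K x y) = K' (\<theta> x) y'"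
  shows "lumps_strongly TYPE('w) \<Omega> K \<theta> \<Omega>' K'"
  unfolding lumps_strongly_def
proof (intro conjI allI impI \<Omega>')
  fix M :: "'w measure" and X
  assume chain: "markov_chain M \<Omega> K X"
  then interpret prob_space M by (simp add: markov_chain_def)
  have fin: "finite \<Omega>" and K: "transition_matrix \<Omega> K"
    and X: "X t \<in> measurable M (count_space \<Omega>)" for t
    using chain unfolding markov_chain_def by blast+
  have step: "\<P>(\<omega> in M. X (Suc t) \<omega> = y \<bar> \<forall>s\<le>t. X s \<omega> = x s) = K (x t) y"
    if "y \<in> \<Omega>" "\<P>(\<omega> in M. \<forall>s\<le>t. X s \<omega> = x s) \<noteq> 0" for t x y
    using chain that unfolding markov_chain_def by blast
  have X_mem: "X t \<omega> \<in> \<Omega>" if "\<omega> \<in> space M" for t \<omega>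
    using measurable_space[OF X that] by simp
  have X_sets: "{\<omega> \<in> space M. X t \<omega> = z} \<in> sets M" for t z
  proof -
    \<comment> \<open>The value \<open>z\<close> may lie outside \<open>\<Omega>\<close>;
      intersecting with \<open>\<Omega>\<close> yields a set measurable in
      \<open>count_space \<Omega>\<close>.\<close>
    have "{\<omega> \<in> space M. X t \<omega> = z} = X t -` ({z} \<inter> \<Omega>) \<inter> space M"
      using X_mem by auto
    then show ?thesis using measurable_sets[OF X, of "{z} \<inter> \<Omega>" t] by simp
  qed
  have path_sets: "{\<omega> \<in> space M. \<forall>s\<le>t. X s \<omega> = x s} \<in> sets M" for t x
    using sets.sets_Collect_finite_All[of "{..t}" M "\<lambda>s \<omega>. X s \<omega> = x s"] X_sets by simp
  have K': "transition_matrix \<Omega>' K'"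
    unfolding transition_matrix_def
  proof (intro ballI conjI)
    fix x' assume "x' \<in> \<Omega>'"
    then obtain x where x: "x \<in> \<Omega>" "x' = \<theta> x" using \<Omega>' by auto
    show "0 \<le> K' x' y'" if "y' \<in> \<Omega>'" for y'
      unfolding x(2) lump[OF x(1) that, symmetric]
      using K x(1) by (intro sum_nonneg) (simp add: transition_matrix_def)
    have "(\<Sum>y'\<in>\<Omega>'. K' x' y') = (\<Sum>y'\<in>\<theta> ` \<Omega>. \<Sum>y | y \<in> \<Omega> \<and> \<theta> y = y'. K x y)"
      unfolding \<Omega>' by (intro sum.cong) (simp_all add: lump x)
    \<comment> \<open>The fibres of \<open>\<theta>\<close> partition
      \<open>\<Omega>\<close>.\<close>
    also have "\<dots> = (\<Sum>y\<in>\<Omega>. K x y)"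
      by (rule sum.image_gen[OF fin, symmetric])
    finally show "(\<Sum>y'\<in>\<Omega>'. K' x' y') = 1"
      using K x by (simp add: transition_matrix_def)
  qed
  have "\<theta> \<in> measurable (count_space \<Omega>) (count_space \<Omega>')"
    using \<Omega>' by auto
  from measurable_compose[OF X this] have meas: "(\<lambda>\<omega>. \<theta> (X t \<omega>)) \<in> measurable M (count_space \<Omega>')" for t .
  have cond: "\<P>(\<omega> in M. \<theta> (X (Suc t) \<omega>) = y' \<bar> \<forall>s\<le>t. \<theta> (X s \<omega>) = x' s) = K' (x' t) y'"
    if y': "y' \<in> \<Omega>'" and pos: "\<P>(\<omega> in M. \<forall>s\<le>t. \<theta> (X s \<omega>) = x' s) \<noteq> 0" for t x' y'
  proof -
    \<comment> \<open>\<open>S\<close> holds the lifts of the image path \<open>x'\<close> up to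
      time \<open>t\<close>. Extensionality outside \<open>{..t}\<close> makes \<open>S\<close>
      finite and distinct lifts differ at some time up to \<open>t\<close>, so their events are
      disjoint.\<close>
    define S where "S = PiE {..t} (\<lambda>s. {z \<in> \<Omega>. \<theta> z = x' s})"
    define E where "E x = {\<omega> \<in> space M. \<forall>s\<le>t. X s \<omega> = x s}" for x
    define F where "F x y = {\<omega> \<in> space M. X (Suc t) \<omega> = y \<and> (\<forall>s\<le>t. X s \<omega> = x s)}" for x y
    let ?Y = "{y \<in> \<Omega>. \<theta> y = y'}"
    have S: "finite S" unfolding S_def using fin by (intro finite_PiE) auto
    have path: "\<exists>x\<in>S. \<forall>s\<le>t. X s \<omega> = x s"
      if "\<omega> \<in> space M" "\<forall>s\<le>t. \<theta> (X s \<omega>) = x' s" for \<omega>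
      using that X_mem by (intro bexI[of _ "restrict (\<lambda>s. X s \<omega>) {..t}"]) (auto simp: S_def)
    have S_eq: "x = z" if "x \<in> S" "z \<in> S" "\<forall>s\<le>t. x s = z s" for x z
      using that unfolding S_def by (intro PiE_ext[of x "{..t}" _ z]) auto
    have E_sets: "E x \<in> sets M" for x unfolding E_def by (rule path_sets)
    have F_sets: "F x y \<in> sets M" for x y
    proof -
      have "F x y = {\<omega> \<in> space M. X (Suc t) \<omega> = y} \<inter> E x" by (auto simp: E_def F_def)
      then show ?thesis by (simp only: sets.Int[OF X_sets E_sets])
    qed
    \<comment> \<open>The Markov property in product form also covers null pasts, where both sides
      are 0.\<close>
    have F: "prob (F x y) = prob (E x) * K (x t) y" if "y \<in> \<Omega>" for x y
    proof (cases "prob (E x) = 0")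
      case True
      have "prob (F x y) \<le> prob (E x)"
        by (rule finite_measure_mono[OF _ E_sets]) (auto simp: E_def F_def)
      then show ?thesis using True by (simp add: measure_le_0_iff)
    next
      case False
      then show ?thesis
        using step[OF that, of t x] by (simp add: cond_prob_def E_def F_def divide_eq_eq mult.commute)
    qed
    have "{\<omega> \<in> space M. \<forall>s\<le>t. \<theta> (X s \<omega>) = x' s} = (\<Union>x\<in>S. E x)"
      using path by (auto simp: E_def S_def PiE_mem)
    moreover have "disjoint_family_on E S"
      using S_eq by (fastforce simp: disjoint_family_on_def E_def)
    ultimately have A: "\<P>(\<omega> in M. \<forall>s\<le>t. \<theta> (X s \<omega>) = x' s) = (\<Sum>x\<in>S. prob (E x))"
      using finite_measure_finite_Union[OF S, of E] E_sets by (simp add: image_subset_iff)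
    have "{\<omega> \<in> space M. \<theta> (X (Suc t) \<omega>) = y' \<and> (\<forall>s\<le>t. \<theta> (X s \<omega>) = x' s)}
        = (\<Union>(x, y)\<in>S \<times> ?Y. F x y)"
    proof (intro equalityI subsetI)
      fix \<omega> assume \<omega>: "\<omega> \<in> {\<omega> \<in> space M. \<theta> (X (Suc t) \<omega>) = y' \<and> (\<forall>s\<le>t. \<theta> (X s \<omega>) = x' s)}"
      then obtain x where "x \<in> S" "\<forall>s\<le>t. X s \<omega> = x s" using path by blast
      then show "\<omega> \<in> (\<Union>(x, y)\<in>S \<times> ?Y. F x y)"
        using \<omega> X_mem by (auto simp: F_def intro!: bexI[of _ x])
    qed (auto simp: F_def S_def PiE_mem)
    moreover have "disjoint_family_on (\<lambda>(x, y). F x y) (S \<times> ?Y)"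
      using S_eq by (fastforce simp: disjoint_family_on_def F_def)
    ultimately have "\<P>(\<omega> in M. \<theta> (X (Suc t) \<omega>) = y' \<and> (\<forall>s\<le>t. \<theta> (X s \<omega>) = x' s))
        = (\<Sum>(x, y)\<in>S \<times> ?Y. prob (F x y))"
      using finite_measure_finite_Union[of "S \<times> ?Y" "\<lambda>(x, y). F x y"] S fin F_sets
      by (simp add: case_prod_unfold image_subset_iff)
    also have "\<dots> = (\<Sum>x\<in>S. \<Sum>y\<in>?Y. prob (F x y))"
      by (rule sum.cartesian_product[symmetric])
    also have "\<dots> = (\<Sum>x\<in>S. prob (E x) * (\<Sum>y\<in>?Y. K (x t) y))"
      by (simp add: F sum_distrib_left)
    \<comment> \<open>Every lift ends in the fibre over \<open>x' t\<close>, so the inner sum no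
      longer depends on \<open>x\<close>.\<close>
    also have "\<dots> = (\<Sum>x\<in>S. prob (E x) * K' (x' t) y')"
    proof (intro sum.cong refl)
      fix x assume "x \<in> S"
      then have "x t \<in> \<Omega>" "\<theta> (x t) = x' t" by (auto simp: S_def PiE_mem)
      then show "prob (E x) * (\<Sum>y\<in>?Y. K (x t) y) = prob (E x) * K' (x' t) y'"
        using lump[OF _ y', of "x t"] by simp
    qed
    \<comment> \<open>Dividing by the nonzero probability of the image past cancels the common sum
      over \<open>S\<close>.\<close>
    finally show ?thesis
      using pos by (simp add: cond_prob_def A flip: sum_distrib_right)
  qed
  show "markov_chain M \<Omega>' K' (\<lambda>t \<omega>. \<theta> (X t \<omega>))"
    unfolding markov_chain_def
    using prob_space_axioms finite_imageI[OF fin, of \<theta>, unfolded \<Omega>'] K' meas cond by blast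
qed

section \<open>Morphisms mapping basis to basis, and the Doob matrices\<close>

locale graded_hopf_basis_morphism = graded_hopf_morphism +
  fixes B B'
  assumes basis: "graded_basis H B" and basis': "graded_basis H' B'"
    and basis_image: "\<And>k. \<theta> ` B k = B' k"
begin

lemma basis_facts:
  "finite (B k)" "independent (B k)" "span (B k) = H k"
  "finite (B' k)" "independent (B' k)" "span (B' k) = H' k"
  using basis basis' by (auto simp: graded_basis_def)

lemma rescaling_hom:
  assumes "B 1 = {b}"
  shows "rescaling H' \<Delta>' \<epsilon>' B' n (\<theta> x) = rescaling H \<Delta> \<epsilon> B n x"
proof -
  let ?u = "tens (replicate n b)" and ?u' = "tens (replicate n (\<theta> b))"
  have B'1: "B' 1 = {\<theta> b}" using assms basis_image[of 1] by auto
  \<comment> \<open>Elements of independent sets are nonzero, hence so are their tensor powers; thus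
    each of \<open>?u\<close>, \<open>?u'\<close> is a basis of its line.\<close>
  have "b \<noteq> 0" "\<theta> b \<noteq> 0"
    using basis_facts(2,5)[of 1] assms B'1 by auto
  then have indep: "independent {?u}" "independent {?u'}"
    by (simp_all add: tens_replicate_nonzero)
  have "coproduct_part H \<Delta> \<epsilon> (replicate n 1) x \<in> span {?u}"
    unfolding coproduct_part_eq using basis_facts(3)[of 1] assms
    by (intro degree_projection_replicate_mem[OF dom.grading]) simp
  then obtain c where c: "coproduct_part H \<Delta> \<epsilon> (replicate n 1) x = c *\<^sub>R ?u"
    by (auto simp: span_singleton)
  then have c': "coproduct_part H' \<Delta>' \<epsilon>' (replicate n 1) (\<theta> x) = c *\<^sub>R ?u'"
    by (simp only: coproduct_part_hom linear_scale[OF linear_tensor_map[OF linear_hom]]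
        tensor_map_tens[OF linear_hom] map_replicate)
  have "representation {?u} (c *\<^sub>R ?u) ?u = c" "representation {?u'} (c *\<^sub>R ?u') ?u' = c"
    using indep by (simp_all add: real_vector.representation_scale real_vector.representation_basis span_base)
  then show ?thesis
    by (simp only: rescaling_def assms B'1 tensor_basis_singleton the_elem_eq c c')
qed

text \<open>The fibre formula is applied to each weak composition separately; summability then
  permits exchanging the finite fibre sum with the infinite sum.\<close>

lemma representation_descent_operator_hom:
  assumes "y' \<in> B' n"
  shows "representation (B' n) (descent_operator H' \<Delta>' \<epsilon>' B' n P (\<theta> x)) y' =
    (\<Sum>y | y \<in> B n \<and> \<theta> y = y'. representation (B n) (descent_operator H \<Delta> \<epsilon> B n P x) y)"
proof -
  let ?c = "\<lambda>D. pmf P D / multinomial D" and ?Y = "{y \<in> B n. \<theta> y = y'}"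
  have "representation (B' n) (descent_operator H' \<Delta>' \<epsilon>' B' n P (\<theta> x)) y' =
      (\<Sum>\<^sub>\<infinity>D\<in>weak_compositions n. ?c D * representation (B' n) (\<theta> (descent_term H \<Delta> \<epsilon> D x)) y')"
    by (simp add: representation_descent_operator basis_facts assms descent_term_hom)
  also have "\<dots> = (\<Sum>\<^sub>\<infinity>D\<in>weak_compositions n.
      \<Sum>y\<in>?Y. ?c D * representation (B n) (descent_term H \<Delta> \<epsilon> D x) y)"
  proof (rule infsum_cong)
    fix D assume "D \<in> weak_compositions n"
    then have "descent_term H \<Delta> \<epsilon> D x \<in> span (B n)"
      using dom.descent_term_mem[of D x] by (simp add: basis_facts weak_compositions_def)
    then have "representation (B' n) (\<theta> (descent_term H \<Delta> \<epsilon> D x)) y' =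
        (\<Sum>y\<in>?Y. representation (B n) (descent_term H \<Delta> \<epsilon> D x) y)"
      by (intro representation_linear_image) (simp_all add: basis_facts linear_hom basis_image)
    then show "?c D * representation (B' n) (\<theta> (descent_term H \<Delta> \<epsilon> D x)) y' =
        (\<Sum>y\<in>?Y. ?c D * representation (B n) (descent_term H \<Delta> \<epsilon> D x) y)"
      by (simp only: sum_distrib_left)
  qed
  also have "\<dots> = (\<Sum>y\<in>?Y. \<Sum>\<^sub>\<infinity>D\<in>weak_compositions n.
      ?c D * representation (B n) (descent_term H \<Delta> \<epsilon> D x) y)"
    using basis_facts(1)
    by (intro infsumI has_sum_finite_sum has_sum_infsum dom.descent_coefficient_summable) simp
  also have "\<dots> = (\<Sum>y\<in>?Y. representation (B n) (descent_operator H \<Delta> \<epsilon> B n P x) y)"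
    by (intro sum.cong refl) (simp add: representation_descent_operator basis_facts)
  finally show ?thesis .
qed

lemma doob_matrix_lump:
  assumes b: "B 1 = {b}" and y': "y' \<in> B' n"
  shows "(\<Sum>y | y \<in> B n \<and> \<theta> y = y'. doob_matrix H \<Delta> \<epsilon> B n P x y) =
    doob_matrix H' \<Delta>' \<epsilon>' B' n P (\<theta> x) y'"
proof -
  \<comment> \<open>On the fibre over \<open>y'\<close> the rescaling quotient is constant and
    equals the one for the image chain, so it factors out of the sum.\<close>
  have "doob_matrix H \<Delta> \<epsilon> B n P x y = representation (B n) (descent_operator H \<Delta> \<epsilon> B n P x) y *
      (rescaling H' \<Delta>' \<epsilon>' B' n y' / rescaling H' \<Delta>' \<epsilon>' B' n (\<theta> x))" if "\<theta> y = y'" for y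
    by (simp only: doob_matrix_def rescaling_hom[OF b] flip: that)
  then show ?thesis
    by (simp add: doob_matrix_def representation_descent_operator_hom[OF y'] sum_distrib_right
        sum_divide_distrib)
qed

end

theorem theorem3p6:
  fixes H :: "nat \<Rightarrow> 'a::real_algebra_1 set" and H' :: "nat \<Rightarrow> 'b::real_algebra_1 set"
    and \<Delta> :: "'a \<Rightarrow> 'a tensor" and \<Delta>' :: "'b \<Rightarrow> 'b tensor"
    and \<epsilon> :: "'a \<Rightarrow> real" and \<epsilon>' :: "'b \<Rightarrow> real"
    and B :: "nat \<Rightarrow> 'a set" and B' :: "nat \<Rightarrow> 'b set"
    and \<theta> :: "'a \<Rightarrow> 'b"
    and n :: nat and P :: "nat list pmf"
  assumes "graded_connected_hopf_algebra H \<Delta> \<epsilon>"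
    and "graded_connected_hopf_algebra H' \<Delta>' \<epsilon>'"
    and "graded_basis H B" and "graded_basis H' B'"
    and "descent_chain_conditions \<Delta> B" and "descent_chain_conditions \<Delta>' B'"
    and "hopf_morphism \<Delta> \<epsilon> \<Delta>' \<epsilon>' \<theta>"
    and "\<And>k. \<theta> ` B k = B' k"
    and "n \<ge> 1"
    and "set_pmf P \<subseteq> weak_compositions n"
  shows "lumps_strongly TYPE('w)
           (B n) (doob_matrix H \<Delta> \<epsilon> B n P) \<theta> (B' n) (doob_matrix H' \<Delta>' \<epsilon>' B' n P)"
proof -
  have "linear \<theta>" using assms(7) by (simp add: hopf_morphism_def)
  \<comment> \<open>The image of the span of \<open>B k\<close> is the span of its image
    \<open>B' k\<close>.\<close>
  then have "\<theta> ` H k = H' k" for k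
    using linear_span_image[of \<theta> "B k"] assms(3,4,8) by (simp add: graded_basis_def)
  then interpret graded_hopf_basis_morphism H \<Delta> \<epsilon> H' \<Delta>' \<epsilon>' \<theta> B B'
    using assms
    by (simp add: graded_hopf_basis_morphism_def graded_hopf_basis_morphism_axioms_def
        graded_hopf_morphism_def graded_hopf_morphism_axioms_def)
  obtain b where "B 1 = {b}"
    using assms(5) by (auto simp: descent_chain_conditions_def)
  then show ?thesis
    by (intro lumps_stronglyI assms(8) doob_matrix_lump)
qed

end
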